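(* Work over the max-plus semifield $\mathbb{R}_{\max,+}=(\mathbb{R}\cup\{-\infty\},\oplus,\otimes)$. Let $A,B,C$ be $n\times n$ matrices with entries in $\mathbb{R}\cup\{-\infty\}$ and let $g$ be a vector of order $n$ with entries in $\mathbb{R}\cup\{-\infty\}$. Consider the problem of finding regular vectors $x$ and vectors $y$ of order $n$ that $$\text{minimize } x^{-}y\quad\text{subject to}\quad Ax=y,\quad Bx\leq x,\quad Cy\leq x,\quad g\leq x .$$ Suppose that $A$ has spectral radius $\lambda>\mathbb{0}$ and that the matrix $D=B\oplus CA$ satisfies $\mathrm{Tr}(D)\leq\mathbb{1}$. Then the minimum value of the problem is equal to $$\theta=\lambda\oplus\bigoplus_{k=1}^{n-1}\ \bigoplus_{1\leq i_{1}+\cdots+i_{k}\leq n-k}\mathrm{tr}^{1/k}(AD^{i_{1}}\cdots AD^{i_{k}}),$$ where the inner sum is over nonnegative integers $i_{1},\ldots,i_{k}$ satisfying the indicated condition, and all solutions with $x$ regular are given by $$x=(\theta^{-1}A\oplus D)^{\ast}u,\qquad y=A(\theta^{-1}A\oplus D)^{\ast}u,$$ where $u$ is any regular vector with $u\geq g$.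
   Context: Max-plus semifield: on $\mathbb{X}=\mathbb{R}\cup\{-\infty\}$ put $a\oplus b=\max(a,b)$ and $a\otimes b=a+b$ (the sign $\otimes$ is omitted), with zero $\mathbb{0}=-\infty$ and identity $\mathbb{1}=0$ (the real number zero). For $a\in\mathbb{R}$, $a^{-1}=-a$, and for a rational exponent $p$ the power $a^{p}$ is the ordinary product $pa$; also $\mathbb{0}^{p}=\mathbb{0}$ for $p>0$. The order is the usual order on $\mathbb{R}\cup\{-\infty\}$, and it extends entrywise to vectors and matrices. Matrix addition, matrix multiplication and scalar multiplication follow the standard rules with $\oplus,\otimes$ in place of $+,\times$. $I$ is the identity matrix ($\mathbb{1}$ on the diagonal, $\mathbb{0}$ elsewhere); $M^{0}=I$, $M^{p}=M^{p-1}M$. Vectors are column vectors. A vector is regular if none of its entries is $\mathbb{0}$. Multiplicative conjugate transpose of a vector $x=(x_i)$: the row vector $x^{-}$ with entries $x_i^{-1}$ if $x_i\neq\mathbb{0}$ and $\mathbb{0}$ otherwise. For an $n\times n$ matrix $M$: $\mathrm{tr}\,M=\bigoplus_{i=1}^{n}m_{ii}$, $\mathrm{tr}^{1/k}(M)=(\mathrm{tr}\,M)^{1/k}$, $\mathrm{Tr}(M)=\bigoplus_{k=1}^{n}\mathrm{tr}(M^{k})$; the spectral radius of $M$ (its maximum eigenvalue) is $\lambda=\bigoplus_{k=1}^{n}\mathrm{tr}^{1/k}(M^{k})$; and $M^{\ast}=\bigoplus_{k=0}^{n-1}M^{k}$ (used for matrices with $\mathrm{Tr}(M)\leq\mathbb{1}$).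 A solution is a feasible pair $(x,y)$ attaining the minimum. *)

theory Defs
  imports "HOL-Analysis.Analysis"
begin

datatype maxplus = MinusInf | Fin real

instantiation maxplus :: linorder
begin

fun less_eq_maxplus :: "maxplus \<Rightarrow> maxplus \<Rightarrow> bool" where
  "MinusInf \<le> b \<longleftrightarrow> True"
| "Fin x \<le> MinusInf \<longleftrightarrow> False"
| "Fin x \<le> Fin y \<longleftrightarrow> x \<le> y"

definition less_maxplus :: "maxplus \<Rightarrow> maxplus \<Rightarrow> bool" where
  "a < b \<longleftrightarrow> a \<le> b \<and> \<not> b \<le> (a :: maxplus)"

instance
proof
  fix a b c :: maxplus
  show "a < b \<longleftrightarrow> a \<le> b \<and> \<not> b \<le> a"
    by (rule less_maxplus_def)
  show "a \<le> a"
    by (cases a) auto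
  show "a \<le> b \<Longrightarrow> b \<le> c \<Longrightarrow> a \<le> c"
    by (cases a; cases b; cases c) auto
  show "a \<le> b \<Longrightarrow> b \<le> a \<Longrightarrow> a = b"
    by (cases a; cases b) auto
  show "a \<le> b \<or> b \<le> a"
    by (cases a; cases b) auto
qed

end

text \<open>
  The type class operations are the max-plus ones: \<open>+\<close> is the maximum, \<open>*\<close> is real addition,
  \<open>0\<close> is minus infinity and \<open>1\<close> is the real number zero. Hence \<open>\<Sum>\<close>, \<open>**\<close>, \<open>*v\<close>, \<open>*s\<close>, \<open>mat 1\<close>
  and \<open>trace\<close> from the library denote the max-plus matrix operations at this type.
\<close>

instantiation maxplus :: comm_semiring_1
begin

definition zero_maxplus :: maxplus where
  "0 = MinusInf"

definition one_maxplus :: maxplus where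
  "1 = Fin 0"

definition plus_maxplus :: "maxplus \<Rightarrow> maxplus \<Rightarrow> maxplus" where
  "a + b = max a (b :: maxplus)"

fun times_maxplus :: "maxplus \<Rightarrow> maxplus \<Rightarrow> maxplus" where
  "MinusInf * b = MinusInf"
| "Fin x * MinusInf = MinusInf"
| "Fin x * Fin y = Fin (x + y)"

instance
proof
  fix a b c :: maxplus
  show "a + b + c = a + (b + c)"
    by (simp add: plus_maxplus_def max.assoc)
  show "a + b = b + a"
    by (simp add: plus_maxplus_def max.commute)
  show "0 + a = a"
    by (cases a) (simp_all add: plus_maxplus_def zero_maxplus_def max_def)
  show "a * b * c = a * (b * c)"
    by (cases a; cases b; cases c) auto
  show "a * b = b * a"
    by (cases a; cases b) auto
  show "1 * a = a"
    by (cases a) (auto simp: one_maxplus_def)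
  show "(a + b) * c = a * c + b * c"
    by (cases a; cases b; cases c) (auto simp: plus_maxplus_def max_def)
  show "0 * a = 0" and "a * 0 = 0"
    by (cases a; simp add: zero_maxplus_def)+
  show "(0 :: maxplus) \<noteq> 1"
    by (simp add: zero_maxplus_def one_maxplus_def)
qed

end

text \<open>The value \<open>inverse 0 = 0\<close> is the one used for zero entries in the conjugate transpose.\<close>

instantiation maxplus :: inverse
begin

fun inverse_maxplus :: "maxplus \<Rightarrow> maxplus" where
  "inverse MinusInf = MinusInf"
| "inverse (Fin x) = Fin (- x)"

definition divide_maxplus :: "maxplus \<Rightarrow> maxplus \<Rightarrow> maxplus" where
  "a div b = a * inverse (b :: maxplus)"

instance ..

end

text \<open>For \<open>a = 0\<close> the rational power is only meaningful for a positive exponent.\<close>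

fun powq :: "maxplus \<Rightarrow> rat \<Rightarrow> maxplus" (infixr \<open>powq\<close> 80) where
  "MinusInf powq p = MinusInf"
| "Fin x powq p = Fin (of_rat p * x)"

text \<open>The library power \<open>^\<close> acts entrywise on matrices, so the matrix power is defined here.\<close>

fun matpow :: "maxplus ^ 'n ^ 'n \<Rightarrow> nat \<Rightarrow> maxplus ^ 'n ^ 'n" where
  "matpow M 0 = mat 1"
| "matpow M (Suc p) = matpow M p ** M"

definition matscale :: "maxplus \<Rightarrow> maxplus ^ 'n ^ 'm \<Rightarrow> maxplus ^ 'n ^ 'm" where
  "matscale c M = (\<chi> i. c *s (M $ i))"

definition regular :: "maxplus ^ 'n \<Rightarrow> bool" where
  "regular x \<longleftrightarrow> (\<forall>i. x $ i \<noteq> 0)"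

definition conj_transpose :: "maxplus ^ 'n \<Rightarrow> maxplus ^ 'n" where
  "conj_transpose x = (\<chi> i. if x $ i \<noteq> 0 then inverse (x $ i) else 0)"

definition row_times_col :: "maxplus ^ 'n \<Rightarrow> maxplus ^ 'n \<Rightarrow> maxplus" where
  "row_times_col r c = (\<Sum>i\<in>UNIV. r $ i * c $ i)"

definition Tr :: "maxplus ^ 'n ^ 'n \<Rightarrow> maxplus" where
  "Tr M = (\<Sum>k = 1..CARD('n). trace (matpow M k))"

definition mp_spectral_radius :: "maxplus ^ 'n ^ 'n \<Rightarrow> maxplus" where
  "mp_spectral_radius M = (\<Sum>k = 1..CARD('n). trace (matpow M k) powq (1 / of_nat k))"

definition star :: "maxplus ^ 'n ^ 'n \<Rightarrow> maxplus ^ 'n ^ 'n" where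
  "star M = (\<Sum>k = 0..CARD('n) - 1. matpow M k)"

text \<open>\<open>word_prod A D [i\<^sub>1, \<dots>, i\<^sub>k]\<close> is the product of the \<open>A ** matpow D i\<^sub>j\<close> in order.\<close>

definition word_prod ::
    "maxplus ^ 'n ^ 'n \<Rightarrow> maxplus ^ 'n ^ 'n \<Rightarrow> nat list \<Rightarrow> maxplus ^ 'n ^ 'n" where
  "word_prod A D is = foldr (\<lambda>i P. A ** matpow D i ** P) is (mat 1)"

definition feasible ::
    "maxplus ^ 'n ^ 'n \<Rightarrow> maxplus ^ 'n ^ 'n \<Rightarrow> maxplus ^ 'n ^ 'n \<Rightarrow> maxplus ^ 'n \<Rightarrow>
      (maxplus ^ 'n) \<times> (maxplus ^ 'n) \<Rightarrow> bool" where
  "feasible A B C g = (\<lambda>(x, y).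
     regular x \<and> A *v x = y \<and> B *v x \<le> x \<and> C *v y \<le> x \<and> g \<le> x)"

definition objective :: "(maxplus ^ 'n) \<times> (maxplus ^ 'n) \<Rightarrow> maxplus" where
  "objective = (\<lambda>(x, y). row_times_col (conj_transpose x) y)"

definition is_minimum_of :: "'a::order \<Rightarrow> 'a set \<Rightarrow> bool" where
  "is_minimum_of m S \<longleftrightarrow> m \<in> S \<and> (\<forall>s\<in>S. m \<le> s)"

end

theory Submission
  imports Defs
begin

text \<open>
  Eliminating \<open>y\<close> leaves the regular vectors \<open>x \<ge> g\<close> with \<open>D x \<le> x\<close>, and on them the objective
  \<open>x\<^sup>- A x\<close> is at most \<open>c\<close> exactly if \<open>A x \<le> c x\<close>. Everything therefore turns on the question for
  which scalars \<open>c\<close> the two inequalities \<open>A x \<le> c x\<close> and \<open>D x \<le> x\<close> have a common regular solution,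
  and \<open>\<theta>\<close> is designed to be the least such \<open>c\<close>. The lemma \<open>theta_le_iff\<close> reads its definition in
  this way: \<open>\<theta> \<le> c\<close> holds if and only if every product \<open>A D\<^sup>i\<^sup>1 \<cdots> A D\<^sup>i\<^sup>k\<close> with at most \<open>n\<close> factors
  and \<open>k \<ge> 1\<close> has trace at most \<open>c\<^sup>k\<close>.

  These bounds are necessary, since such a product maps a common solution \<open>x\<close> below \<open>c\<^sup>k x\<close>, which
  bounds its diagonal by \<open>c\<^sup>k\<close> (\<open>theta_le_objective\<close>). They are also sufficient if \<open>c \<noteq> 0\<close>. Put
  \<open>M = c\<^sup>-\<^sup>1 A + D\<close>, so that the two inequalities together say \<open>M x \<le> x\<close>. An entry of a power \<open>M\<^sup>m\<close> is
  attained by one word of length \<open>m\<close> in \<open>c\<^sup>-\<^sup>1 A\<close> and \<open>D\<close>. Since the trace is invariant under cyclic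
  rotation, a word that contains \<open>A\<close> can be rotated to begin with \<open>A\<close>, which is the form occurring in
  \<open>\<theta>\<close>; a word without \<open>A\<close> is controlled by \<open>Tr D \<le> 1\<close>. Hence \<open>Tr M \<le> 1\<close>
  (\<open>Tr_scaled_plus_le_one\<close>).

  If \<open>Tr M \<le> 1\<close>, then no cycle of length at most \<open>n\<close> has weight above \<open>1\<close>. Cutting a cycle out of a
  path of length \<open>n\<close> gives \<open>M\<^sup>n \<le> M\<^sup>*\<close>, hence \<open>M M\<^sup>* \<le> M\<^sup>*\<close>, and the regular solutions of \<open>M x \<le> x\<close>,
  \<open>g \<le> x\<close> are exactly the vectors \<open>M\<^sup>* u\<close> with \<open>u\<close> regular and \<open>g \<le> u\<close>
  (\<open>subinvariant_iff_star_image\<close>). For \<open>c = \<theta>\<close> this parametrises all feasible points with objective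
  at most \<open>\<theta>\<close>, which are the solutions because \<open>\<theta>\<close> is a lower bound.
\<close>

section \<open>The max-plus semifield as an ordered semiring\<close>

text \<open>With these classes the library's lemmas on monotonicity of \<open>*\<close>, powers and finite sums apply.\<close>

instance maxplus :: canonically_ordered_monoid_add
proof
  fix a b :: maxplus
  show "a \<le> b \<longleftrightarrow> (\<exists>c. b = a + c)"
    by (auto simp: plus_maxplus_def max_def)
qed

instance maxplus :: ordered_comm_semiring
proof
  fix a b c :: maxplus
  show "c * a \<le> c * b" if "a \<le> b"
    using that by (cases a; cases b; cases c) auto
qed

lemma maxplus_plus_le_iff [simp]: "a + b \<le> c \<longleftrightarrow> a \<le> c \<and> b \<le> (c :: maxplus)"
  by (simp add: plus_maxplus_def)

lemma maxplus_sum_le_iff: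
  fixes f :: "'a \<Rightarrow> maxplus"
  assumes "finite S"
  shows "sum f S \<le> c \<longleftrightarrow> (\<forall>x\<in>S. f x \<le> c)"
  using assms by (induction S rule: finite_induct) auto

lemma maxplus_le_sum:
  fixes f :: "'a \<Rightarrow> maxplus"
  assumes "finite S" and "x \<in> S"
  shows "f x \<le> sum f S"
  using maxplus_sum_le_iff[of S f "sum f S"] assms by auto

text \<open>A maximum over a finite set is attained; this is what singles out optimal paths and words.\<close>

lemma maxplus_sum_attained:
  fixes f :: "'a \<Rightarrow> maxplus"
  assumes "finite S" and "S \<noteq> {}"
  shows "\<exists>x\<in>S. sum f S = f x"
  using assms
proof (induction S rule: finite_ne_induct)
  case (insert y S)
  then obtain x where x: "x \<in> S" "sum f S = f x"
    by blast
  have "sum f (insert y S) = max (f y) (f x)"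
    using insert x by (simp add: plus_maxplus_def)
  then show ?case
    using x by (auto simp: max_def)
qed simp

lemma maxplus_mult_mono: "a \<le> b \<Longrightarrow> c \<le> d \<Longrightarrow> a * c \<le> b * (d :: maxplus)"
  by (rule mult_mono) simp_all

lemma maxplus_inverse_mult [simp]: "c \<noteq> 0 \<Longrightarrow> inverse c * c = (1 :: maxplus)"
  by (cases c) (auto simp: zero_maxplus_def one_maxplus_def)

lemma maxplus_inverse_mult_le_iff:
  "c \<noteq> 0 \<Longrightarrow> inverse c * a \<le> b \<longleftrightarrow> a \<le> c * (b :: maxplus)"
  by (cases a; cases b; cases c) (auto simp: zero_maxplus_def)

lemma maxplus_mult_right_cancel_le:
  "x \<noteq> 0 \<Longrightarrow> a * x \<le> b * x \<Longrightarrow> a \<le> (b :: maxplus)"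
  by (cases a; cases b; cases x) (auto simp: zero_maxplus_def)

lemma Fin_power: "Fin r ^ k = Fin (real k * r)"
  by (induction k) (auto simp: one_maxplus_def algebra_simps)

lemma powq_inverse_le_iff:
  assumes "k \<ge> 1"
  shows "a powq (1 / of_nat k) \<le> b \<longleftrightarrow> a \<le> b ^ k"
proof -
  have "MinusInf ^ k = MinusInf"
    using assms zero_power[of k, where 'a = maxplus] by (simp add: zero_maxplus_def)
  then show ?thesis
    using assms
    by (cases a; cases b) (auto simp: Fin_power of_rat_divide field_simps)
qed

section \<open>Max-plus matrices and paths\<close>

lemma matrix_mult_mono:
  fixes P Q :: "maxplus ^ 'n ^ 'm" and R S :: "maxplus ^ 'l ^ 'n"
  assumes "P \<le> Q" and "R \<le> S"
  shows "P ** R \<le> Q ** S"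
  using assms
  by (auto simp: less_eq_vec_def matrix_matrix_mult_def intro!: sum_mono maxplus_mult_mono)

lemma matrix_vector_mult_mono:
  fixes P :: "maxplus ^ 'n ^ 'm"
  assumes "x \<le> y"
  shows "P *v x \<le> P *v y"
  using assms
  by (auto simp: less_eq_vec_def matrix_vector_mult_def intro!: sum_mono maxplus_mult_mono)

lemma matrix_vector_mult_le_iff:
  fixes P :: "maxplus ^ 'n ^ 'm"
  shows "P *v x \<le> y \<longleftrightarrow> (\<forall>i j. P $ i $ j * x $ j \<le> y $ i)"
  by (auto simp: less_eq_vec_def matrix_vector_mult_def maxplus_sum_le_iff)

lemma add_le_vec_iff:
  fixes x y z :: "maxplus ^ 'n"
  shows "x + y \<le> z \<longleftrightarrow> x \<le> z \<and> y \<le> z"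
  by (auto simp: less_eq_vec_def)

lemma matpow_add: "matpow M (a + b) = matpow M a ** matpow M b"
  by (induction b) (simp_all add: matrix_mul_assoc)

lemma matpow_Suc_left: "matpow M (Suc k) = M ** matpow M k"
  using matpow_add[of M 1 k] by simp

lemma matpow_entry_mult_le:
  "matpow M a $ i $ l * matpow M b $ l $ j \<le> matpow M (a + b) $ i $ j"
  unfolding matpow_add matrix_matrix_mult_def
  by (simp add: maxplus_le_sum[where f = "\<lambda>l. matpow M a $ i $ l * matpow M b $ l $ j"])

lemma trace_le_iff:
  fixes M :: "maxplus ^ 'n ^ 'n"
  shows "trace M \<le> c \<longleftrightarrow> (\<forall>i. M $ i $ i \<le> c)"
  by (simp add: trace_def maxplus_sum_le_iff)

lemma Tr_le_one_iff:
  fixes M :: "maxplus ^ 'n ^ 'n"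
  shows "Tr M \<le> 1 \<longleftrightarrow> (\<forall>k\<in>{1..CARD('n)}. trace (matpow M k) \<le> 1)"
  by (simp add: Tr_def maxplus_sum_le_iff)

lemma path_weight_le_matpow:
  assumes "a \<le> b"
  shows "(\<Prod>t\<in>{a..<b}. M $ p t $ p (Suc t)) \<le> matpow M (b - a) $ p a $ p b"
  using assms
proof (induction b rule: dec_induct)
  case base
  then show ?case
    by (simp add: mat_def)
next
  case (step b)
  have "(\<Prod>t\<in>{a..<Suc b}. M $ p t $ p (Suc t))
      = (\<Prod>t\<in>{a..<b}. M $ p t $ p (Suc t)) * M $ p b $ p (Suc b)"
    using step by (simp add: prod.atLeastLessThan_Suc)
  also have "\<dots> \<le> matpow M (b - a) $ p a $ p b * matpow M 1 $ p b $ p (Suc b)"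
    using step.IH by (intro maxplus_mult_mono) simp_all
  also have "\<dots> \<le> matpow M (b - a + 1) $ p a $ p (Suc b)"
    by (rule matpow_entry_mult_le)
  finally show ?case
    using step by (simp add: Suc_diff_le)
qed

text \<open>
  The exceptional value \<open>0\<close> is needed because there need not be any path at all: off its diagonal,
  \<open>matpow M 0\<close> has zero entries that no path of length \<open>0\<close> accounts for.
\<close>

lemma matpow_entry_attained_by_path:
  "matpow M k $ i $ j = 0 \<or>
    (\<exists>p. p 0 = i \<and> p k = j \<and> matpow M k $ i $ j = (\<Prod>t\<in>{0..<k}. M $ p t $ p (Suc t)))"
proof (induction k arbitrary: j)
  case 0
  show ?case
  proof (cases "i = j")
    case True
    then show ?thesis
      by (auto simp: mat_def intro!: exI[of _ "\<lambda>_. i"])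
  qed (simp add: mat_def)
next
  case (Suc k)
  obtain l where l: "matpow M (Suc k) $ i $ j = matpow M k $ i $ l * M $ l $ j"
    using maxplus_sum_attained[of UNIV "\<lambda>l. matpow M k $ i $ l * M $ l $ j"]
    by (auto simp: matrix_matrix_mult_def)
  show ?case
  proof (cases "matpow M k $ i $ l = 0")
    case True
    then show ?thesis
      using l by simp
  next
    case False
    then obtain p where p: "p 0 = i" "p k = l"
        "matpow M k $ i $ l = (\<Prod>t\<in>{0..<k}. M $ p t $ p (Suc t))"
      using Suc.IH[of l] by blast
    have "(\<Prod>t\<in>{0..<k}. M $ (p(Suc k := j)) t $ (p(Suc k := j)) (Suc t))
        = (\<Prod>t\<in>{0..<k}. M $ p t $ p (Suc t))"
      by (intro prod.cong) auto
    then have "matpow M (Suc k) $ i $ j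
        = (\<Prod>t\<in>{0..<Suc k}. M $ (p(Suc k := j)) t $ (p(Suc k := j)) (Suc t))"
      using l p by (simp add: prod.atLeastLessThan_Suc)
    then show ?thesis
      using p(1) by (intro disjI2 exI[of _ "p(Suc k := j)"]) simp
  qed
qed

section \<open>The Kleene star and subinvariant vectors\<close>

lemma star_entry: "star M $ i $ j = (\<Sum>k = 0..CARD('n) - 1. matpow M k $ i $ j)"
  for M :: "maxplus ^ 'n ^ 'n"
  by (simp add: star_def)

lemma matpow_le_star:
  fixes M :: "maxplus ^ 'n ^ 'n"
  assumes "k < CARD('n)"
  shows "matpow M k $ i $ j \<le> star M $ i $ j"
  unfolding star_entry using assms
  by (intro maxplus_le_sum[where f = "\<lambda>k. matpow M k $ i $ j"]) auto

text \<open>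
  A path of length \<open>n\<close> visits \<open>n + 1\<close> vertices and so contains a cycle of length at most \<open>n\<close>. The
  hypothesis bounds the weight of this cycle by \<open>1\<close>, and removing it leaves a path of length below \<open>n\<close>
  that weighs at least as much.
\<close>

lemma matpow_card_le_star:
  fixes M :: "maxplus ^ 'n ^ 'n"
  assumes "Tr M \<le> 1"
  shows "matpow M (CARD('n)) $ i $ j \<le> star M $ i $ j"
proof (cases "matpow M (CARD('n)) $ i $ j = 0")
  case False
  let ?n = "CARD('n)"
  obtain p where p: "p 0 = i" "p ?n = j"
      "matpow M ?n $ i $ j = (\<Prod>t\<in>{0..<?n}. M $ p t $ p (Suc t))"
    using matpow_entry_attained_by_path[of M ?n i j] False by blast
  have "card (p ` {0..?n}) < card {0..?n}"
    using card_mono[of UNIV "p ` {0..?n}"] by simp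
  then have "\<not> inj_on p {0..?n}"
    using card_image by fastforce
  then obtain a b where ab: "a < b" "b \<le> ?n" "p a = p b"
    by (auto simp: inj_on_def) (metis linorder_neqE_nat)
  let ?w = "\<lambda>t. M $ p t $ p (Suc t)"
  have "prod ?w {0..<?n} = prod ?w {0..<a} * prod ?w {a..<b} * prod ?w {b..<?n}"
    using ab by (simp add: prod.atLeastLessThan_concat)
  also have "\<dots> \<le> matpow M a $ i $ p a * 1 * matpow M (?n - b) $ p b $ j"
  proof (intro maxplus_mult_mono)
    show "prod ?w {0..<a} \<le> matpow M a $ i $ p a"
      using path_weight_le_matpow[of 0 a M p] p by simp
    have "prod ?w {a..<b} \<le> matpow M (b - a) $ p a $ p a"
      using path_weight_le_matpow[of a b M p] ab by simp
    also have "\<dots> \<le> 1"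
    proof -
      have "b - a \<in> {1..?n}"
        using ab by auto
      then show ?thesis
        using assms unfolding Tr_le_one_iff trace_le_iff by blast
    qed
    finally show "prod ?w {a..<b} \<le> 1" .
    show "prod ?w {b..<?n} \<le> matpow M (?n - b) $ p b $ j"
      using path_weight_le_matpow[of b ?n M p] p ab by simp
  qed
  also have "\<dots> \<le> matpow M (a + (?n - b)) $ i $ j"
    using matpow_entry_mult_le[of M a i "p a" "?n - b" j] ab by simp
  also have "\<dots> \<le> star M $ i $ j"
    using ab by (intro matpow_le_star) simp
  finally show ?thesis
    using p by simp
qed simp

lemma mult_star_le_star:
  fixes M :: "maxplus ^ 'n ^ 'n"
  assumes "Tr M \<le> 1"
  shows "M ** star M \<le> star M"
proof -
  have "M $ i $ l * star M $ l $ j \<le> star M $ i $ j" for i l j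
  proof -
    obtain k where k: "k \<in> {0..CARD('n) - 1}" "star M $ l $ j = matpow M k $ l $ j"
      using maxplus_sum_attained[of "{0..CARD('n) - 1}" "\<lambda>k. matpow M k $ l $ j"]
      by (auto simp: star_entry)
    have "M $ i $ l * star M $ l $ j \<le> matpow M (1 + k) $ i $ j"
      using matpow_entry_mult_le[of M 1 i l k j] k by simp
    also have "\<dots> \<le> star M $ i $ j"
    proof (cases "1 + k < CARD('n)")
      case True
      then show ?thesis
        by (rule matpow_le_star)
    next
      case False
      then have "1 + k = CARD('n)"
        using k(1) zero_less_card_finite[where 'a = 'n] unfolding atLeastAtMost_iff by linarith
      then show ?thesis
        using matpow_card_le_star[OF assms] by metis
    qed
    finally show ?thesis .
  qed
  then show ?thesis
    by (auto simp: less_eq_vec_def matrix_matrix_mult_def maxplus_sum_le_iff)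
qed

lemma le_star_vector: "u \<le> star M *v u" for M :: "maxplus ^ 'n ^ 'n"
proof -
  have "u $ i \<le> (star M *v u) $ i" for i
  proof -
    have "1 \<le> star M $ i $ i"
      using matpow_le_star[of 0 M i i] by (simp add: mat_def)
    then have "u $ i \<le> star M $ i $ i * u $ i"
      using maxplus_mult_mono[of 1 _ "u $ i" "u $ i"] by simp
    also have "\<dots> \<le> (star M *v u) $ i"
      using maxplus_le_sum[of UNIV i "\<lambda>j. star M $ i $ j * u $ j"]
      by (simp add: matrix_vector_mult_def)
    finally show ?thesis .
  qed
  then show ?thesis
    by (simp add: less_eq_vec_def)
qed

lemma matpow_subinvariant:
  assumes "M *v x \<le> x"
  shows "matpow M k *v x \<le> x"
proof (induction k)
  case (Suc k)
  have "matpow M (Suc k) *v x = matpow M k *v (M *v x)"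
    by (simp add: matrix_vector_mul_assoc)
  also have "\<dots> \<le> matpow M k *v x"
    using assms by (rule matrix_vector_mult_mono)
  finally show ?case
    using Suc by simp
qed simp

lemma star_fixes_subinvariant:
  fixes M :: "maxplus ^ 'n ^ 'n"
  assumes "M *v x \<le> x"
  shows "star M *v x = x"
proof (rule order.antisym)
  have "star M $ i $ j * x $ j \<le> x $ i" for i j
  proof -
    obtain k where "star M $ i $ j = matpow M k $ i $ j"
      using maxplus_sum_attained[of "{0..CARD('n) - 1}" "\<lambda>k. matpow M k $ i $ j"]
      by (auto simp: star_entry)
    then show ?thesis
      using matpow_subinvariant[OF assms, of k] by (simp add: matrix_vector_mult_le_iff)
  qed
  then show "star M *v x \<le> x"
    by (simp add: matrix_vector_mult_le_iff)
qed (rule le_star_vector)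

lemma regular_mono: "regular u \<Longrightarrow> u \<le> x \<Longrightarrow> regular x"
  by (auto simp: regular_def less_eq_vec_def) (metis le_zero_eq)

text \<open>
  A subinvariant \<open>x\<close> is its own parameter, as \<open>star M\<close> fixes it. Conversely \<open>star M *v u\<close> is
  subinvariant by \<open>mult_star_le_star\<close>, and it inherits regularity and the lower bound \<open>g\<close> from \<open>u\<close>
  because it dominates \<open>u\<close>.
\<close>

lemma subinvariant_iff_star_image:
  fixes M :: "maxplus ^ 'n ^ 'n"
  assumes "Tr M \<le> 1"
  shows "regular x \<and> g \<le> x \<and> M *v x \<le> x \<longleftrightarrow> (\<exists>u. regular u \<and> g \<le> u \<and> x = star M *v u)"
proof
  assume "regular x \<and> g \<le> x \<and> M *v x \<le> x"
  then show "\<exists>u. regular u \<and> g \<le> u \<and> x = star M *v u"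
    using star_fixes_subinvariant[of M x] by auto
next
  assume "\<exists>u. regular u \<and> g \<le> u \<and> x = star M *v u"
  then obtain u where u: "regular u" "g \<le> u" "x = star M *v u"
    by blast
  have "M *v x \<le> x"
  proof -
    have "(M ** star M) $ i $ j * u $ j \<le> x $ i" for i j
    proof -
      have "(M ** star M) $ i $ j * u $ j \<le> star M $ i $ j * u $ j"
        using mult_star_le_star[OF assms] by (intro maxplus_mult_mono) (auto simp: less_eq_vec_def)
      also have "\<dots> \<le> x $ i"
        using order.refl[of x] unfolding u(3) matrix_vector_mult_le_iff by simp
      finally show ?thesis .
    qed
    then show ?thesis
      by (simp add: u(3) matrix_vector_mul_assoc matrix_vector_mult_le_iff)
  qed
  moreover have "u \<le> x"
    unfolding u(3) by (rule le_star_vector)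
  ultimately show "regular x \<and> g \<le> x \<and> M *v x \<le> x"
    using u regular_mono order.trans by blast
qed

section \<open>Words in two matrices\<close>

lemma word_prod_Nil [simp]: "word_prod A D [] = mat 1"
  by (simp add: word_prod_def)

lemma word_prod_Cons [simp]:
  "word_prod A D (i # is) = A ** matpow D i ** word_prod A D is"
  by (simp add: word_prod_def)

lemma word_prod_replicate_0: "word_prod A D (replicate k 0) = matpow A k"
proof (induction k)
  case (Suc k)
  then show ?case
    by (simp add: matpow_Suc_left del: matpow.simps(2))
qed simp

text \<open>Over all words of a given length, these are the terms of the expansion of a power of \<open>P + Q\<close>.\<close>

primrec mixed_prod :: "maxplus ^ 'n ^ 'n \<Rightarrow> maxplus ^ 'n ^ 'n \<Rightarrow> bool list \<Rightarrow> maxplus ^ 'n ^ 'n"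
  where
    "mixed_prod P Q [] = mat 1"
  | "mixed_prod P Q (b # w) = (if b then P else Q) ** mixed_prod P Q w"

lemma mixed_prod_append: "mixed_prod P Q (v @ w) = mixed_prod P Q v ** mixed_prod P Q w"
  by (induction v) (simp_all add: matrix_mul_assoc)

lemma mixed_prod_only_right: "True \<notin> set w \<Longrightarrow> mixed_prod P Q w = matpow Q (length w)"
proof (induction w)
  case (Cons b w)
  then show ?case
    by (cases b) (simp_all add: matpow_Suc_left del: matpow.simps(2))
qed simp

lemma matpow_plus_entry_le_mixed_prod:
  "\<exists>w. length w = m \<and> matpow (P + Q) m $ i $ j \<le> mixed_prod P Q w $ i $ j"
proof (induction m arbitrary: j)
  case (Suc m)
  obtain l where l: "matpow (P + Q) (Suc m) $ i $ j = matpow (P + Q) m $ i $ l * (P + Q) $ l $ j"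
    using maxplus_sum_attained[of UNIV "\<lambda>l. matpow (P + Q) m $ i $ l * (P + Q) $ l $ j"]
    by (auto simp: matrix_matrix_mult_def)
  obtain w where w: "length w = m" "matpow (P + Q) m $ i $ l \<le> mixed_prod P Q w $ i $ l"
    using Suc.IH by blast
  obtain b where b: "(P + Q) $ l $ j = mixed_prod P Q [b] $ l $ j"
  proof (cases "P $ l $ j \<le> Q $ l $ j")
    case True
    then show ?thesis
      by (intro that[of False]) (simp add: plus_maxplus_def max_def)
  next
    case False
    then show ?thesis
      by (intro that[of True]) (simp add: plus_maxplus_def max_def)
  qed
  have "matpow (P + Q) (Suc m) $ i $ j \<le> mixed_prod P Q w $ i $ l * mixed_prod P Q [b] $ l $ j"
    unfolding l b using w by (intro maxplus_mult_mono) simp_all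
  also have "\<dots> \<le> mixed_prod P Q (w @ [b]) $ i $ j"
    unfolding mixed_prod_append matrix_matrix_mult_def[of "mixed_prod P Q w"]
    using maxplus_le_sum[of UNIV l "\<lambda>l. mixed_prod P Q w $ i $ l * mixed_prod P Q [b] $ l $ j"]
    by simp
  finally show ?case
    using w(1) by (intro exI[of _ "w @ [b]"]) simp
qed simp

text \<open>Grouping the letters of a word by the occurrences of \<open>A\<close> leaves a block of \<open>D\<close> in front.\<close>

lemma mixed_prod_eq_word_prod:
  "\<exists>i is. mixed_prod A D w = matpow D i ** word_prod A D is \<and>
    length is = count_list w True \<and> i + sum_list is = count_list w False"
proof (induction w)
  case Nil
  show ?case
    by (intro exI[of _ 0] exI[of _ "[]"]) simp
next
  case (Cons b w)
  then obtain i "is" where *: "mixed_prod A D w = matpow D i ** word_prod A D is"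
      "length is = count_list w True" "i + sum_list is = count_list w False"
    by blast
  show ?case
  proof (cases b)
    case True
    then show ?thesis
      using * by (intro exI[of _ 0] exI[of _ "i # is"]) (simp add: matrix_mul_assoc)
  next
    case False
    then show ?thesis
      using *
      by (intro exI[of _ "Suc i"] exI[of _ "is"])
        (simp add: matpow_Suc_left matrix_mul_assoc del: matpow.simps(2))
  qed
qed

lemma matscale_entry [simp]: "matscale c M $ i $ j = c * M $ i $ j"
  by (simp add: matscale_def)

lemma matscale_mult_left: "matscale c P ** Q = matscale c (P ** Q)"
  by (simp add: vec_eq_iff matrix_matrix_mult_def sum_distrib_left mult.assoc)

lemma matscale_mult_right: "P ** matscale c Q = matscale c (P ** Q)"
  by (simp add: vec_eq_iff matrix_matrix_mult_def sum_distrib_left mult.left_commute)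

lemma matscale_matscale: "matscale a (matscale b P) = matscale (a * b) P"
  by (simp add: vec_eq_iff mult.assoc)

lemma mixed_prod_matscale:
  "mixed_prod (matscale c A) D w = matscale (c ^ count_list w True) (mixed_prod A D w)"
proof (induction w)
  case Nil
  show ?case
    by (simp add: vec_eq_iff)
next
  case (Cons b w)
  then show ?case
    by (simp add: matscale_mult_left matscale_mult_right matscale_matscale mult.commute)
qed

section \<open>The minimum value as a bound on traces of words\<close>

lemma finite_lists_bounded_sum:
  "finite {is :: nat list. length is = k \<and> 1 \<le> sum_list is \<and> sum_list is \<le> m}"
proof (rule finite_subset)
  show "{is. length is = k \<and> 1 \<le> sum_list is \<and> sum_list is \<le> m}
      \<subseteq> {is. set is \<subseteq> {..m} \<and> length is = k}"
    using member_le_sum_list by fastforce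
  show "finite {is :: nat list. set is \<subseteq> {..m} \<and> length is = k}"
    by (rule finite_lists_length_eq) simp
qed

text \<open>
  The spectral radius contributes the words whose exponents are all zero, and the double sum
  contributes the others. The latter have \<open>k < n\<close>, since at least one factor is \<open>D\<close>.
\<close>

lemma theta_le_iff:
  fixes A D :: "maxplus ^ 'n ^ 'n"
  shows "mp_spectral_radius A + (\<Sum>k = 1..CARD('n) - 1.
          \<Sum>is\<in>{is. length is = k \<and> 1 \<le> sum_list is \<and> sum_list is \<le> CARD('n) - k}.
            trace (word_prod A D is) powq (1 / of_nat k)) \<le> c
    \<longleftrightarrow> (\<forall>is. is \<noteq> [] \<and> length is + sum_list is \<le> CARD('n)
          \<longrightarrow> trace (word_prod A D is) \<le> c ^ length is)"
    (is "?\<theta> \<le> c \<longleftrightarrow> ?words")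
proof -
  let ?n = "CARD('n)"
  let ?S = "\<lambda>k. {is :: nat list. length is = k \<and> 1 \<le> sum_list is \<and> sum_list is \<le> ?n - k}"
  have "?\<theta> \<le> c \<longleftrightarrow> (\<forall>k\<in>{1..?n}. trace (matpow A k) powq (1 / of_nat k) \<le> c) \<and>
      (\<forall>k\<in>{1..?n - 1}. \<forall>is\<in>?S k. trace (word_prod A D is) powq (1 / of_nat k) \<le> c)"
    unfolding mp_spectral_radius_def maxplus_plus_le_iff
    by (simp only: maxplus_sum_le_iff finite_lists_bounded_sum finite_atLeastAtMost)
  also have "\<dots> \<longleftrightarrow> (\<forall>k\<in>{1..?n}. trace (matpow A k) \<le> c ^ k) \<and>
      (\<forall>k\<in>{1..?n - 1}. \<forall>is\<in>?S k. trace (word_prod A D is) \<le> c ^ k)"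
    by (simp add: powq_inverse_le_iff)
  also have "\<dots> \<longleftrightarrow> ?words"
  proof (intro iffI allI impI conjI ballI)
    fix "is" :: "nat list"
    assume L: "(\<forall>k\<in>{1..?n}. trace (matpow A k) \<le> c ^ k) \<and>
      (\<forall>k\<in>{1..?n - 1}. \<forall>is\<in>?S k. trace (word_prod A D is) \<le> c ^ k)"
      and "is": "is \<noteq> [] \<and> length is + sum_list is \<le> ?n"
    have len: "1 \<le> length is"
      using "is" by (simp add: Suc_leI)
    show "trace (word_prod A D is) \<le> c ^ length is"
    proof (cases "sum_list is = 0")
      case True
      then have "is = replicate (length is) 0"
        by (intro replicate_eqI) auto
      then have "word_prod A D is = matpow A (length is)"
        by (metis word_prod_replicate_0)
      then show ?thesis
        using L "is" len by auto
    next
      case False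
      then have "length is \<in> {1..?n - 1}" and "is \<in> ?S (length is)"
        using "is" len by (auto simp del: sum_list_eq_0_iff)
      then show ?thesis
        using L by blast
    qed
  next
    fix k
    assume ?words and "k \<in> {1..?n}"
    then show "trace (matpow A k) \<le> c ^ k"
      by (auto dest!: spec[of _ "replicate k 0"] simp: word_prod_replicate_0 sum_list_replicate)
  next
    fix k "is"
    assume ?words and "k \<in> {1..?n - 1}" and "is \<in> ?S k"
    then show "trace (word_prod A D is) \<le> c ^ k"
      by (auto dest!: spec[of _ "is"])
  qed
  finally show ?thesis .
qed

lemma word_prod_subinvariant:
  assumes "A *v x \<le> c *s x" and "D *v x \<le> x"
  shows "word_prod A D is *v x \<le> c ^ length is *s x"
proof (induction "is")
  case (Cons i "is")
  have scale: "P *v (a *s y) = a *s (P *v y)" for P :: "maxplus ^ 'a ^ 'a" and a and y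
    by (simp add: vec_eq_iff matrix_vector_mult_def sum_distrib_left mult.left_commute)
  have scale_mono: "y \<le> z \<Longrightarrow> a *s y \<le> a *s z" for y z :: "maxplus ^ 'a" and a
    by (auto simp: less_eq_vec_def intro: maxplus_mult_mono)
  let ?a = "c ^ length is"
  have "word_prod A D (i # is) *v x = A *v (matpow D i *v (word_prod A D is *v x))"
    by (simp add: matrix_vector_mul_assoc matrix_mul_assoc)
  also have "\<dots> \<le> A *v (matpow D i *v (?a *s x))"
    using Cons.IH by (intro matrix_vector_mult_mono)
  also have "\<dots> = ?a *s (A *v (matpow D i *v x))"
    by (simp add: scale)
  also have "\<dots> \<le> ?a *s (A *v x)"
    using matpow_subinvariant[OF assms(2)] by (intro scale_mono matrix_vector_mult_mono)
  also have "\<dots> \<le> ?a *s (c *s x)"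
    using assms(1) by (rule scale_mono)
  also have "\<dots> = c ^ length (i # is) *s x"
    by (simp add: vec_eq_iff mult_ac)
  finally show ?case .
qed simp

text \<open>Regularity allows \<open>x $ i\<close> to be cancelled from \<open>M $ i $ i * x $ i \<le> c * x $ i\<close>.\<close>

lemma trace_le_of_subinvariant:
  assumes "regular x" and "M *v x \<le> c *s x"
  shows "trace M \<le> c"
  using assms maxplus_mult_right_cancel_le
  by (fastforce simp: trace_le_iff matrix_vector_mult_le_iff regular_def)

lemma objective_le_iff:
  assumes "regular x"
  shows "objective (x, y) \<le> c \<longleftrightarrow> y \<le> c *s x"
proof -
  have "inverse (x $ i) * y $ i \<le> c \<longleftrightarrow> y $ i \<le> c * x $ i" for i
    using assms maxplus_inverse_mult_le_iff[of "x $ i" "y $ i" c]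
    by (simp add: regular_def mult.commute)
  then show ?thesis
    using assms
    by (simp add: objective_def row_times_col_def conj_transpose_def maxplus_sum_le_iff
        regular_def less_eq_vec_def)
qed

text \<open>
  The least \<open>c\<close> with \<open>A x \<le> c x\<close> is the objective value of \<open>x\<close>, and for this \<open>c\<close> every word satisfies
  the bound that \<open>theta_le_iff\<close> asks for.
\<close>

lemma theta_le_objective:
  fixes A D :: "maxplus ^ 'n ^ 'n"
  assumes "regular x" and "D *v x \<le> x"
  shows "mp_spectral_radius A + (\<Sum>k = 1..CARD('n) - 1.
          \<Sum>is\<in>{is. length is = k \<and> 1 \<le> sum_list is \<and> sum_list is \<le> CARD('n) - k}.
            trace (word_prod A D is) powq (1 / of_nat k)) \<le> objective (x, A *v x)"
proof -
  have "A *v x \<le> objective (x, A *v x) *s x"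
    using objective_le_iff[OF assms(1)] by blast
  then show ?thesis
    unfolding theta_le_iff
    using trace_le_of_subinvariant[OF assms(1)] word_prod_subinvariant[OF _ assms(2)] by blast
qed

text \<open>
  The word bounds are also sufficient. They concern only words that begin with \<open>A\<close>, but any word
  containing \<open>A\<close> can be rotated into that form without changing its trace.
\<close>

lemma Tr_scaled_plus_le_one:
  fixes A D :: "maxplus ^ 'n ^ 'n"
  assumes "c \<noteq> 0" and "Tr D \<le> 1"
    and words: "\<And>is. is \<noteq> [] \<Longrightarrow> length is + sum_list is \<le> CARD('n)
      \<Longrightarrow> trace (word_prod A D is) \<le> c ^ length is"
  shows "Tr (matscale (inverse c) A + D) \<le> 1"
proof -
  have mixed: "trace (mixed_prod A D w) \<le> c ^ count_list w True"
    if w: "1 \<le> length w" "length w \<le> CARD('n)" for w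
  proof (cases "True \<in> set w")
    case False
    then show ?thesis
      using assms(2) w by (auto simp: mixed_prod_only_right Tr_le_one_iff)
  next
    case True
    then obtain u v where uv: "w = u @ True # v"
      by (auto dest: split_list)
    obtain i "is" where *: "mixed_prod A D (v @ u) = matpow D i ** word_prod A D is"
        "length is = count_list (v @ u) True" "i + sum_list is = count_list (v @ u) False"
      using mixed_prod_eq_word_prod by blast
    have "count_list x True + count_list x False = length x" for x
      by (induction x) auto
    then have len: "length is + (i + sum_list is) = length (v @ u)"
      using * by metis
    have "trace (mixed_prod A D w) = trace (mixed_prod A D (True # v @ u))"
      unfolding uv using trace_mul_sym[of "mixed_prod A D u" "mixed_prod A D (True # v)"]
      by (simp add: mixed_prod_append matrix_mul_assoc)
    also have "\<dots> = trace (word_prod A D (i # is))"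
      using * by (simp add: matrix_mul_assoc)
    also have "\<dots> \<le> c ^ length (i # is)"
      using w(2) len by (intro words) (simp_all add: uv)
    also have "\<dots> = c ^ count_list w True"
      using * by (simp add: uv add.commute)
    finally show ?thesis .
  qed
  have "matpow (matscale (inverse c) A + D) m $ i $ i \<le> 1"
    if m: "1 \<le> m" "m \<le> CARD('n)" for m i
  proof -
    obtain w where w: "length w = m" "matpow (matscale (inverse c) A + D) m $ i $ i
        \<le> mixed_prod (matscale (inverse c) A) D w $ i $ i"
      using matpow_plus_entry_le_mixed_prod by blast
    let ?k = "count_list w True"
    have "mixed_prod A D w $ i $ i \<le> c ^ ?k"
      using mixed[of w] w m by (simp add: trace_le_iff)
    then have "inverse c ^ ?k * mixed_prod A D w $ i $ i \<le> inverse c ^ ?k * c ^ ?k"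
      by (intro maxplus_mult_mono) simp_all
    also have "\<dots> = 1"
      using assms(1) by (simp flip: power_mult_distrib)
    finally show ?thesis
      using w by (simp add: mixed_prod_matscale)
  qed
  then show ?thesis
    by (simp add: Tr_le_one_iff trace_le_iff)
qed

section \<open>The optimization problem\<close>

lemma feasible_iff:
  "feasible A B C g (x, y) \<longleftrightarrow>
    regular x \<and> g \<le> x \<and> y = A *v x \<and> (B + C ** A) *v x \<le> x"
  by (auto simp: feasible_def matrix_vector_mult_add_rdistrib add_le_vec_iff matrix_vector_mul_assoc)

lemma matscale_subinvariant_iff:
  assumes "c \<noteq> 0"
  shows "matscale (inverse c) A *v x \<le> x \<longleftrightarrow> A *v x \<le> c *s x"
  using assms by (simp add: matrix_vector_mult_le_iff mult.assoc maxplus_inverse_mult_le_iff)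

lemma exists_regular_ge: "\<exists>u :: maxplus ^ 'n. regular u \<and> g \<le> u"
proof (intro exI conjI)
  have "max a 1 \<noteq> 0" for a :: maxplus
    by (cases a) (auto simp: max_def zero_maxplus_def one_maxplus_def)
  then show "regular (\<chi> i. max (g $ i) 1)"
    by (simp add: regular_def)
  show "g \<le> (\<chi> i. max (g $ i) 1)"
    by (simp add: less_eq_vec_def)
qed

theorem theorem9:
  fixes A B C D :: "maxplus ^ 'n ^ 'n"
    and g :: "maxplus ^ 'n"
    and lam \<theta> :: maxplus
  assumes lam_def: "lam = mp_spectral_radius A"
    and lam_pos: "lam > 0"
    and D_def: "D = B + C ** A"
    and Tr_D: "Tr D \<le> 1"
    and theta_def: "\<theta> = lam + (\<Sum>k = 1..CARD('n) - 1.
          \<Sum>is\<in>{is. length is = k \<and> 1 \<le> sum_list is \<and> sum_list is \<le> CARD('n) - k}.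
            trace (word_prod A D is) powq (1 / of_nat k))"
  shows "is_minimum_of \<theta> (objective ` {p. feasible A B C g p}) \<and>
    {p. is_arg_min objective (feasible A B C g) p} =
      {(star (matscale (inverse \<theta>) A + D) *v u,
        A *v (star (matscale (inverse \<theta>) A + D) *v u)) | u. regular u \<and> g \<le> u}"
proof -
  define M where "M = matscale (inverse \<theta>) A + D"
  have "lam \<le> \<theta>"
    unfolding theta_def by (simp add: plus_maxplus_def)
  then have nz: "\<theta> \<noteq> 0"
    using lam_pos by auto
  have "Tr M \<le> 1"
    unfolding M_def
  proof (rule Tr_scaled_plus_le_one[OF nz Tr_D])
    fix "is"
    assume "is \<noteq> []" and "length is + sum_list is \<le> CARD('n)"
    then show "trace (word_prod A D is) \<le> \<theta> ^ length is"
      using theta_le_iff[of A D \<theta>] unfolding theta_def lam_def by blast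
  qed
  note star_image = subinvariant_iff_star_image[OF this, of _ g]
  have lower: "\<theta> \<le> objective p" if "feasible A B C g p" for p
    using that theta_le_objective[of "fst p" D A] unfolding theta_def lam_def D_def
    by (cases p) (simp add: feasible_iff)
  \<comment> \<open>The feasible points at level \<open>\<theta>\<close> are the subinvariant vectors of \<open>M\<close> above \<open>g\<close>.\<close>
  have level: "feasible A B C g (x, y) \<and> objective (x, y) \<le> \<theta> \<longleftrightarrow>
      (\<exists>u. regular u \<and> g \<le> u \<and> x = star M *v u) \<and> y = A *v x" for x y
  proof -
    have "M *v x \<le> x \<longleftrightarrow> A *v x \<le> \<theta> *s x \<and> D *v x \<le> x"
      by (simp add: M_def matrix_vector_mult_add_rdistrib add_le_vec_iff
          matscale_subinvariant_iff[OF nz])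
    then show ?thesis
      using star_image[of x] by (auto simp: feasible_iff objective_le_iff D_def)
  qed
  obtain x\<^sub>0 where x0: "feasible A B C g (x\<^sub>0, A *v x\<^sub>0)" "objective (x\<^sub>0, A *v x\<^sub>0) = \<theta>"
    using exists_regular_ge[of g] level lower order.antisym by blast
  have "is_minimum_of \<theta> (objective ` {p. feasible A B C g p})"
    using x0 lower unfolding is_minimum_of_def by force
  moreover have arg_min: "is_arg_min objective (feasible A B C g) p \<longleftrightarrow>
      feasible A B C g p \<and> objective p \<le> \<theta>" for p
    using x0 lower unfolding is_arg_min_def by (metis linorder_not_less order.trans)
  have "{p. is_arg_min objective (feasible A B C g) p} =
      {(star M *v u, A *v (star M *v u)) | u. regular u \<and> g \<le> u}"
    using level unfolding arg_min by fast
  ultimately show ?thesis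
    unfolding M_def by blast
qed

end
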